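(* Let $g\ge 2$ be an integer and let $a_0\in\{1,\dots,g-1\}$. There exists a constant $c=c(g)>0$, depending on $g$, such that, as $x\to\infty$, $$\#\{n\le x:\ n\text{ composite},\ s(n)\text{ has no digit } a_0 \text{ in its base-}g\text{ expansion}\}\ll x\exp\left(-c\sqrt{\log x}\right),$$ where the implied constant may depend on $g$.
   Context: For a positive integer $n$, $s(n)=\sum_{d\mid n,\ d<n} d=\sigma(n)-n$ is the sum of proper divisors of $n$. The base-$g$ expansion is the usual one without leading zeros. *)

theory Defs
  imports Complex_Main "HOL-Computational_Algebra.Primes"
begin

definition sum_proper_divisors :: "nat \<Rightarrow> nat" where
  "sum_proper_divisors n = \<Sum>{d. d dvd n \<and> d < n}"

definition composite :: "nat \<Rightarrow> bool" where
  "composite n \<longleftrightarrow> n > 1 \<and> \<not> prime n"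

(* Least significant digit first, without leading zeros (so 0 has the empty expansion).
   Meaningful only for bases g \<ge> 2; the value [] for g < 2 is a dummy. *)
function base_digits :: "nat \<Rightarrow> nat \<Rightarrow> nat list" where
  "base_digits g m = (if g < 2 \<or> m = 0 then [] else m mod g # base_digits g (m div g))"
  by pat_completeness auto
termination
  by (relation "measure snd") auto

declare base_digits.simps [simp del]

lemma horner_sum_base_digits:
  assumes "g \<ge> 2"
  shows "horner_sum id g (base_digits g m) = m"
  using assms
proof (induction g m rule: base_digits.induct)
  case (1 g m)
  then show ?case
    by (subst base_digits.simps) (auto simp: id_def)
qed

lemma base_digits_less:
  assumes "d \<in> set (base_digits g m)"
  shows "d < g"
  using assms
proof (induction g m rule: base_digits.induct)
  case (1 g m)
  from 1(2) show ?case
    by (subst (asm) base_digits.simps) (use 1(1) in \<open>auto split: if_splits\<close>)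
qed

lemma last_base_digits_neq_0:
  assumes "g \<ge> 2" "m > 0"
  shows "base_digits g m \<noteq> [] \<and> last (base_digits g m) \<noteq> 0"
  using assms
proof (induction g m rule: base_digits.induct)
  case (1 g m)
  show ?case
  proof (cases "m < g")
    case True
    with 1(2,3) show ?thesis
      by (subst (1 2) base_digits.simps) (simp add: base_digits.simps[of g 0])
  next
    case False
    with 1(2) have "m div g > 0"
      by (simp add: div_greater_zero_iff)
    with 1 show ?thesis
      by (subst (1 2) base_digits.simps) auto
  qed
qed

end

theory Submission
  imports Defs "HOL-Analysis.Harmonic_Numbers" "HOL-Real_Asymp.Real_Asymp"
begin

text \<open>
  Put $L = \sqrt{\log x}$ and $Y = e^{L/4}$. By Rankin's trick few $n \le x$ are $Y$-smooth, and few
  are divisible by $p^2$ with $p > Y$. Every other composite $n$ is $mp$ with $p > Y$ prime,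
  $p \nmid m$ and $m \ge 2$, so that $s(n) = (p+1)\,s(m) + m$. Fix $m$, forget that $p$ is prime, and let
  $d = \gcd(s(m), g^k)$: then $s(n) \equiv m$ modulo $d$, and each residue class $a$ modulo $g^k$ with
  $a \equiv m$ modulo $d$ is hit by a proportion $d/g^k$ of the $p \le x/m$.
  If $m < g^j$, then $d \le s(m) \le m^2$ is negligible against the saving $(1-1/g)^k$ for $k = tj$ with
  a large constant $t$. If $m \ge g^j$, take $k = j$ and sum over all divisors $d$ of $g^j$: since
  $m \ge d$, the $m$ are equidistributed modulo $d$, which cancels the factor $d$ and leaves the saving
  $(1-1/g)^j$ up to the number of divisors of $g^j$, a polynomial in $j$.
\<close>

section \<open>Elementary facts on the sum of proper divisors\<close>

text \<open>The divisors of \<open>m * p\<close> prime to \<open>p\<close> are all divisors of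
  \<open>m\<close>, with \<open>m\<close> itself now proper; the others are \<open>p * d\<close>
  with \<open>d\<close> dividing \<open>m\<close>, and they are proper only if
  \<open>d < m\<close>.\<close>

lemma sum_proper_divisors_mult_prime:
  assumes "prime p" "\<not> p dvd m" "m > 0"
  shows "sum_proper_divisors (m * p) = (p + 1) * sum_proper_divisors m + m"
proof -
  have p: "p > 1" using assms(1) by (rule prime_gt_1_nat)
  have divs: "{d. d dvd m} = insert m {d. d dvd m \<and> d < m}"
    using assms(3) by (auto dest: dvd_imp_le)
  have fin: "finite {d. d dvd m \<and> d < m}" by auto
  have "{d. d dvd m * p \<and> d < m * p} = {d. d dvd m} \<union> (\<lambda>d. p * d) ` {d. d dvd m \<and> d < m}"
  proof (intro equalityI subsetI)
    fix d assume "d \<in> {d. d dvd m * p \<and> d < m * p}"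
    hence d: "d dvd m * p" "d < m * p" by auto
    show "d \<in> {d. d dvd m} \<union> (\<lambda>d. p * d) ` {d. d dvd m \<and> d < m}"
    proof (cases "p dvd d")
      case True
      then obtain e where e: "d = p * e" by (elim dvdE)
      have "e dvd m" using d(1) p unfolding e by (simp add: mult.commute)
      moreover have "e < m" using d(2) p unfolding e by (simp add: mult.commute)
      ultimately show ?thesis using e by auto
    next
      case False
      hence "coprime d p" using assms(1) by (metis coprime_commute prime_imp_coprime)
      thus ?thesis using d(1) by (simp add: coprime_dvd_mult_left_iff)
    qed
  next
    fix d assume "d \<in> {d. d dvd m} \<union> (\<lambda>d. p * d) ` {d. d dvd m \<and> d < m}"
    thus "d \<in> {d. d dvd m * p \<and> d < m * p}"
    proof
      assume "d \<in> {d. d dvd m}"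
      hence "d dvd m" by simp
      moreover from this have "d \<le> m" using assms(3) by (simp add: dvd_imp_le)
      moreover have "m < m * p" using p assms(3) by simp
      ultimately have "d dvd m * p" "d < m * p" by (auto intro: le_less_trans)
      thus ?thesis by simp
    next
      assume "d \<in> (\<lambda>d. p * d) ` {d. d dvd m \<and> d < m}"
      thus ?thesis using p by (auto simp: mult.commute)
    qed
  qed
  moreover have "{d. d dvd m} \<inter> (\<lambda>d. p * d) ` {d. d dvd m \<and> d < m} = {}"
    using assms(2) by (auto dest: dvd_mult_left)
  moreover have "finite {d. d dvd m}" using assms(3) by simp
  ultimately have "sum_proper_divisors (m * p) = \<Sum>{d. d dvd m} + \<Sum>((\<lambda>d. p * d) ` {d. d dvd m \<and> d < m})"
    unfolding sum_proper_divisors_def using fin by (simp add: sum.union_disjoint)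
  also have "\<Sum>{d. d dvd m} = m + sum_proper_divisors m"
    unfolding divs sum_proper_divisors_def using fin by simp
  also have "\<Sum>((\<lambda>d. p * d) ` {d. d dvd m \<and> d < m}) = p * sum_proper_divisors m"
    using p by (subst sum.reindex) (auto simp: inj_on_def sum_distrib_left sum_proper_divisors_def)
  finally show ?thesis by simp
qed

text \<open>Crude, but any fixed power of \<open>m\<close> would do: the bound serves small
  \<open>m\<close> only, and a large \<open>t\<close> outweighs it in the end.\<close>

lemma sum_proper_divisors_le_square: "sum_proper_divisors m \<le> m\<^sup>2"
proof -
  have "sum_proper_divisors m \<le> (\<Sum>d\<in>{d. d dvd m \<and> d < m}. m)"
    unfolding sum_proper_divisors_def by (intro sum_mono) auto
  also have "\<dots> = card {d. d dvd m \<and> d < m} * m" by simp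
  also have "card {d. d dvd m \<and> d < m} \<le> card {..<m}" by (intro card_mono) auto
  finally show ?thesis by (simp add: power2_eq_square)
qed

text \<open>The divisor 1 is proper. The excluded case \<open>m = 1\<close>, where the sum vanishes,
  corresponds to prime \<open>n\<close>, which all have the same sum 1.\<close>

lemma sum_proper_divisors_pos:
  assumes "m \<ge> 2"
  shows "sum_proper_divisors m > 0"
proof -
  have "\<Sum>{1::nat} \<le> \<Sum>{d. d dvd m \<and> d < m}"
    using assms by (intro sum_mono2) auto
  thus ?thesis by (simp add: sum_proper_divisors_def)
qed

section \<open>Residues modulo \<open>g ^ k\<close> that avoid a digit\<close>

text \<open>
  For \<open>b \<noteq> 0\<close> it does not matter whether the expansion is padded by leading zeros to length \<open>k\<close>.
\<close>
definition missing_below :: "nat \<Rightarrow> nat \<Rightarrow> nat \<Rightarrow> nat set" where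
  "missing_below g b k = {a. a < g ^ k \<and> b \<notin> set (base_digits g a)}"

lemma set_base_digits:
  assumes "g \<ge> 2" "b > 0"
  shows "b \<in> set (base_digits g a) \<longleftrightarrow> a mod g = b \<or> b \<in> set (base_digits g (a div g))"
proof (cases "a = 0")
  case True
  thus ?thesis using assms by (simp add: base_digits.simps[of g 0])
next
  case False
  thus ?thesis using assms by (subst base_digits.simps) auto
qed

lemma finite_missing_below [simp]: "finite (missing_below g b k)"
  by (rule finite_subset[of _ "{..<g ^ k}"]) (auto simp: missing_below_def)

text \<open>Splitting \<open>a\<close> into \<open>a div g\<close> and \<open>a mod g\<close> leaves
  at most \<open>g - 1\<close> choices for the lowest digit.\<close>

lemma card_missing_below_le:
  assumes "g \<ge> 2" "b \<in> {1..g - 1}"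
  shows "card (missing_below g b k) \<le> (g - 1) ^ k"
proof (induction k)
  case 0
  have "missing_below g b 0 \<subseteq> {0}" by (auto simp: missing_below_def)
  thus ?case using card_mono[of "{0::nat}"] by fastforce
next
  case (Suc k)
  have "card (missing_below g b (Suc k)) \<le> card (missing_below g b k \<times> ({..<g} - {b}))"
  proof (rule card_inj_on_le[where f = "\<lambda>a. (a div g, a mod g)"])
    show "inj_on (\<lambda>a. (a div g, a mod g)) (missing_below g b (Suc k))"
      by (rule inj_onI) (metis Pair_inject div_mult_mod_eq)
    show "(\<lambda>a. (a div g, a mod g)) ` missing_below g b (Suc k) \<subseteq> missing_below g b k \<times> ({..<g} - {b})"
    proof (rule image_subsetI)
      fix a assume a: "a \<in> missing_below g b (Suc k)"
      have "a mod g \<noteq> b" "b \<notin> set (base_digits g (a div g))"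
        using a assms set_base_digits[of g b a] by (auto simp: missing_below_def)
      moreover have "a div g < g ^ k"
        using a by (intro less_mult_imp_div_less) (simp add: missing_below_def mult.commute)
      ultimately show "(a div g, a mod g) \<in> missing_below g b k \<times> ({..<g} - {b})"
        using assms by (simp add: missing_below_def)
    qed
  qed auto
  also have "\<dots> = card (missing_below g b k) * (g - 1)"
    using assms by (subst card_cartesian_product, subst card_Diff_singleton) auto
  also have "\<dots> \<le> (g - 1) ^ Suc k" using Suc by simp
  finally show ?case .
qed

text \<open>Reduction modulo \<open>g ^ k\<close> keeps only the \<open>k\<close> lowest digits.
  This turns the digit condition into a condition on a residue, which is all that the counting below
  uses.\<close>

lemma mod_power_in_missing_below:
  assumes "g \<ge> 2" "b \<in> {1..g - 1}" "b \<notin> set (base_digits g n)"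
  shows "n mod g ^ k \<in> missing_below g b k"
  using assms(3)
proof (induction k arbitrary: n)
  case 0
  thus ?case by (simp add: missing_below_def base_digits.simps[of g 0])
next
  case (Suc k)
  have n: "n mod g \<noteq> b" "b \<notin> set (base_digits g (n div g))"
    using Suc.prems set_base_digits[of g b n] assms by auto
  have e: "n mod g ^ Suc k = g * (n div g mod g ^ k) + n mod g"
    by (simp add: mod_mult2_eq)
  have "(n mod g ^ Suc k) mod g = n mod g" unfolding e by simp
  moreover have "(n mod g ^ Suc k) div g = n div g mod g ^ k" unfolding e using assms(1) by simp
  ultimately have "b \<notin> set (base_digits g (n mod g ^ Suc k))"
    using n Suc.IH[OF n(2)] set_base_digits[of g b "n mod g ^ Suc k"] assms
    by (auto simp: missing_below_def)
  thus ?case using assms(1) by (simp add: missing_below_def)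
qed

section \<open>Counting \<open>p\<close> for a fixed cofactor \<open>m\<close>\<close>

text \<open>Within one residue class modulo \<open>q\<close> an element is determined by its
  quotient; the \<open>+ 1\<close> accounts for quotient 0.\<close>

lemma card_congruent_le:
  fixes S :: "nat set"
  assumes "S \<subseteq> {..X}" "q > 0" "\<And>u v. u \<in> S \<Longrightarrow> v \<in> S \<Longrightarrow> u mod q = v mod q"
  shows "card S \<le> X div q + 1"
proof -
  have "card S \<le> card {..X div q}"
  proof (rule card_inj_on_le[where f = "\<lambda>u. u div q"])
    show "inj_on (\<lambda>u. u div q) S"
      by (rule inj_onI) (metis assms(3) div_mult_mod_eq)
    show "(\<lambda>u. u div q) ` S \<subseteq> {..X div q}" using assms(1) by (auto intro: div_le_mono)
  qed auto
  thus ?thesis by simp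
qed

text \<open>Two solutions satisfy \<open>q dvd s * (u - v)\<close>; cancelling the gcd puts all
  solutions into one class modulo \<open>q div gcd s q\<close>.\<close>

lemma card_linear_congruence_le:
  fixes s q :: nat
  assumes "s > 0" "q > 0"
  shows "card {p \<in> {1..X}. (p * s + r) mod q = a} \<le> X div (q div gcd s q) + 1"
proof (rule card_congruent_le)
  have "gcd s q dvd q" by simp
  thus "q div gcd s q > 0" using assms by (intro gr0I) (simp add: dvd_div_eq_0_iff)
next
  fix u v assume "u \<in> {p \<in> {1..X}. (p * s + r) mod q = a}" "v \<in> {p \<in> {1..X}. (p * s + r) mod q = a}"
  hence "(u * s + r) mod q = (v * s + r) mod q" by simp
  hence "(int u * int s + int r) mod int q = (int v * int s + int r) mod int q"
    by (metis of_nat_add of_nat_mod of_nat_mult)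
  hence "int q dvd (int u * int s + int r) - (int v * int s + int r)"
    by (simp only: mod_eq_dvd_iff)
  hence q: "int q dvd int s * (int u - int v)" by (simp add: algebra_simps)
  define d where "d = gcd s q"
  have d: "d > 0" "d dvd s" "d dvd q" using assms by (auto simp: d_def)
  have cop: "coprime (q div d) (s div d)"
    using assms unfolding d_def by (metis coprime_commute div_gcd_coprime less_numeral_extra(3))
  have "int d * int (q div d) dvd int d * (int (s div d) * (int u - int v))"
    using q d by (metis dvd_mult_div_cancel mult.assoc of_nat_mult)
  hence "int (q div d) dvd int (s div d) * (int u - int v)" using d by simp
  hence "int (q div d) dvd int u - int v"
    using cop by (metis coprime_dvd_mult_right_iff coprime_int_iff)
  hence "int u mod int (q div d) = int v mod int (q div d)" by (simp only: mod_eq_dvd_iff)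
  thus "u mod (q div gcd s q) = v mod (q div gcd s q)"
    unfolding d_def by (metis of_nat_eq_iff of_nat_mod)
qed auto

text \<open>Since \<open>d\<close> divides \<open>s(m)\<close>, the sum for \<open>m * p\<close> is
  congruent to \<open>m\<close> modulo \<open>d\<close>. So only residues \<open>a\<close> with
  \<open>a mod d = m mod d\<close> occur, each for a proportion of about \<open>d / g ^ k\<close> of
  the \<open>p\<close>. The sum over \<open>a\<close> is kept explicit so that a later summation
  over \<open>m\<close> can exploit the congruence.\<close>

lemma card_missing_multiples_le:
  fixes g b k m N :: nat
  assumes "g \<ge> 2" "b \<in> {1..g - 1}" "m \<ge> 2" "g ^ k \<le> N div m"
  defines "d \<equiv> gcd (sum_proper_divisors m) (g ^ k)"
  shows "real (card {p \<in> {1..N div m}. b \<notin> set (base_digits g ((p + 1) * sum_proper_divisors m + m))})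
    \<le> (\<Sum>a | a \<in> missing_below g b k \<and> a mod d = m mod d. 2 * real N * real d / (real m * real (g ^ k)))"
    (is "real (card ?S) \<le> _")
proof -
  define s q X where "s = sum_proper_divisors m" and "q = g ^ k" and "X = N div m"
  define A where "A = {a. a \<in> missing_below g b k \<and> a mod d = m mod d}"
  have s: "s > 0" using assms(3) by (simp add: s_def sum_proper_divisors_pos)
  have q: "q > 0" using assms(1) by (simp add: q_def)
  have d: "d > 0" "d dvd s" "d dvd q" using s by (auto simp: d_def s_def q_def)
  have finA: "finite A" by (simp add: A_def)
  have "?S \<subseteq> (\<Union>a\<in>A. {p \<in> {1..X}. (p * s + (s + m)) mod q = a})"
  proof
    fix p assume p: "p \<in> ?S"
    have "(p * s + (s + m)) mod q mod d = (p * s + (s + m)) mod d"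
      using d by (simp add: mod_mod_cancel)
    also have "\<dots> = ((p + 1) * s + m) mod d" by (simp add: algebra_simps)
    also have "\<dots> = m mod d" using dvd_mult[OF d(2), of "p + 1"] by (metis add_0 dvd_imp_mod_0 mod_add_left_eq)
    finally have "(p * s + (s + m)) mod q mod d = m mod d" .
    moreover have "(p * s + (s + m)) mod q \<in> missing_below g b k"
      using mod_power_in_missing_below[OF assms(1,2), of "(p + 1) * s + m" k] p
      by (simp add: s_def q_def algebra_simps)
    ultimately show "p \<in> (\<Union>a\<in>A. {p \<in> {1..X}. (p * s + (s + m)) mod q = a})"
      using p by (auto simp: A_def X_def)
  qed
  hence "card ?S \<le> card (\<Union>a\<in>A. {p \<in> {1..X}. (p * s + (s + m)) mod q = a})"
    using finA by (intro card_mono) auto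
  also have "\<dots> \<le> (\<Sum>a\<in>A. card {p \<in> {1..X}. (p * s + (s + m)) mod q = a})"
    by (rule card_UN_le[OF finA])
  also have "\<dots> \<le> (\<Sum>a\<in>A. X div (q div d) + 1)"
    using card_linear_congruence_le[OF s q] by (intro sum_mono) (simp add: d_def s_def q_def)
  finally have "real (card ?S) \<le> (\<Sum>a\<in>A. real (X div (q div d) + 1))"
    by (simp only: of_nat_le_iff flip: of_nat_sum)
  also have "\<dots> \<le> (\<Sum>a\<in>A. 2 * real N * real d / (real m * real q))"
  proof (rule sum_mono)
    have "real (X div (q div d)) \<le> real X / real (q div d)"
      by (rule of_nat_div_le_of_nat)
    also have "real (q div d) = real q / real d" using d by (simp add: real_of_nat_div)
    finally have "real (X div (q div d)) \<le> real X * real d / real q" by simp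
    \<comment> \<open>As \<open>q \<le> X\<close> and \<open>d \<ge> 1\<close>, the main term is at
      least 1, so doubling it absorbs the \<open>+ 1\<close>.\<close>
    moreover have "1 \<le> real X * real d / real q"
    proof -
      have "q * 1 \<le> X * d" using assms(4) d by (intro mult_mono) (auto simp: q_def X_def)
      hence "real q \<le> real X * real d" by (simp flip: of_nat_mult)
      thus ?thesis using q by simp
    qed
    moreover have "real X * real d / real q \<le> (real N / real m) * real d / real q"
      unfolding X_def by (intro divide_right_mono mult_right_mono of_nat_div_le_of_nat) auto
    ultimately have "real (X div (q div d) + 1) \<le> 2 * ((real N / real m) * real d / real q)"
      unfolding of_nat_add of_nat_1 by linarith
    thus "real (X div (q div d) + 1) \<le> 2 * real N * real d / (real m * real q)" by (simp add: mult_ac)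
  qed
  finally show ?thesis by (simp add: A_def q_def)
qed

lemma card_missing_below_over_power_le:
  assumes "g \<ge> 2" "b \<in> {1..g - 1}"
  shows "real (card (missing_below g b k)) / real (g ^ k) \<le> (1 - 1 / real g) ^ k"
proof -
  have "real (card (missing_below g b k)) / real (g ^ k) \<le> real ((g - 1) ^ k) / real (g ^ k)"
    using card_missing_below_le[OF assms] by (intro divide_right_mono) (simp_all only: of_nat_le_iff of_nat_0_le_iff)
  also have "\<dots> = (real (g - 1) / real g) ^ k" by (simp add: power_divide)
  also have "real (g - 1) / real g = 1 - 1 / real g"
    using assms(1) by (simp add: of_nat_diff field_simps)
  finally show ?thesis .
qed

section \<open>Summation over the cofactor \<open>m\<close>\<close>

text \<open>As \<open>d \<le> m\<^sup>2\<close>, the excess factor \<open>d / m\<close> is at most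
  \<open>M\<close>, and the number of terms costs another \<open>M\<close>. This is harmless when
  \<open>k\<close> is a large multiple of the logarithm of \<open>M\<close>.\<close>

lemma sum_missing_multiples_small_le:
  assumes "g \<ge> 2" "b \<in> {1..g - 1}" "\<And>m. m \<in> I \<Longrightarrow> 2 \<le> m \<and> m < M \<and> g ^ k \<le> N div m"
  shows "(\<Sum>m\<in>I. real (card {p \<in> {1..N div m}. b \<notin> set (base_digits g ((p + 1) * sum_proper_divisors m + m))}))
    \<le> 2 * real N * real M ^ 2 * (1 - 1 / real g) ^ k"
proof -
  let ?\<rho> = "1 - 1 / real g"
  have \<rho>: "?\<rho> \<ge> 0" using assms(1) by simp
  have finI: "I \<subseteq> {..<M}" using assms(3) by auto
  have "(\<Sum>m\<in>I. real (card {p \<in> {1..N div m}. b \<notin> set (base_digits g ((p + 1) * sum_proper_divisors m + m))}))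
    \<le> (\<Sum>m\<in>I. 2 * real N * real M * ?\<rho> ^ k)"
  proof (rule sum_mono)
    fix m assume "m \<in> I"
    hence m: "m \<ge> 2" "m < M" "g ^ k \<le> N div m" using assms(3) by auto
    define d where "d = gcd (sum_proper_divisors m) (g ^ k)"
    have "d \<le> sum_proper_divisors m" unfolding d_def
      using sum_proper_divisors_pos[OF m(1)] by simp
    also have "\<dots> \<le> m * m" using sum_proper_divisors_le_square[of m] by (simp add: power2_eq_square)
    finally have d: "real d \<le> real m * real m" by (simp flip: of_nat_mult)
    have "real (card {p \<in> {1..N div m}. b \<notin> set (base_digits g ((p + 1) * sum_proper_divisors m + m))})
      \<le> (\<Sum>a | a \<in> missing_below g b k \<and> a mod d = m mod d. 2 * real N * real d / (real m * real (g ^ k)))"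
      unfolding d_def by (rule card_missing_multiples_le[OF assms(1,2) m(1,3)])
    \<comment> \<open>The congruence condition on \<open>a\<close> is dropped: for small
      \<open>m\<close> the loss of the factor \<open>d\<close> is affordable.\<close>
    also have "\<dots> \<le> (\<Sum>a\<in>missing_below g b k. 2 * real N * real d / (real m * real (g ^ k)))"
      by (rule sum_mono2) auto
    also have "\<dots> = 2 * real N * (real d / real m) * (real (card (missing_below g b k)) / real (g ^ k))"
      by simp
    also have "\<dots> \<le> 2 * real N * real M * ?\<rho> ^ k"
    proof (intro mult_mono mult_left_mono card_missing_below_over_power_le assms(1,2))
      have "real d / real m \<le> real m" using d m by (simp add: divide_le_eq)
      thus "real d / real m \<le> real M" using m by linarith
    qed (use \<rho> in auto)
    finally show "real (card {p \<in> {1..N div m}. b \<notin> set (base_digits g ((p + 1) * sum_proper_divisors m + m))})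
      \<le> 2 * real N * real M * ?\<rho> ^ k" .
  qed
  also have "\<dots> = real (card I) * (2 * real N * real M * ?\<rho> ^ k)" by simp
  also have "\<dots> \<le> real M * (2 * real N * real M * ?\<rho> ^ k)"
    using card_mono[OF _ finI] \<rho> by (intro mult_right_mono) auto
  finally show ?thesis by (simp add: power2_eq_square mult_ac)
qed

text \<open>\<open>harm n - ln n\<close> decreases and equals 1 at \<open>n = 1\<close>.\<close>

lemma harm_le_1_plus_ln:
  assumes "N \<ge> 1"
  shows "harm N \<le> 1 + ln (real N)"
  using euler_mascheroni_sequence_decreasing[of 1 N] assms by (simp add: harm_def)

text \<open>On a residue class \<open>m div d\<close> is injective, and
  \<open>m \<ge> d * (m div d)\<close> leads to \<open>1 / d\<close> times a harmonic sum. The start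
  at \<open>d\<close> keeps the quotient positive; a smaller \<open>m\<close> could contribute far
  more than \<open>1 / d\<close>.\<close>

lemma sum_inverse_residue_class_le:
  fixes d N r :: nat
  assumes "d > 0" "N \<ge> 1"
  shows "(\<Sum>m | m \<in> {d..N} \<and> m mod d = r. 1 / real m) \<le> (1 + ln (real N)) / real d"
proof -
  let ?S = "{m. m \<in> {d..N} \<and> m mod d = r}"
  have inj: "inj_on (\<lambda>m. m div d) ?S"
    by (rule inj_onI) (metis (mono_tags, lifting) div_mult_mod_eq mem_Collect_eq)
  have "(\<Sum>m\<in>?S. 1 / real m) \<le> (\<Sum>m\<in>?S. 1 / (real d * real (m div d)))"
  proof (rule sum_mono)
    fix m assume "m \<in> ?S"
    hence m: "d \<le> m" by simp
    hence "m div d > 0" using assms(1) by (simp add: div_greater_zero_iff)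
    moreover have "real d * real (m div d) \<le> real m"
      by (simp flip: of_nat_mult)
    ultimately show "1 / real m \<le> 1 / (real d * real (m div d))"
      using assms(1) m by (intro divide_left_mono mult_pos_pos) auto
  qed
  also have "\<dots> = (\<Sum>j\<in>(\<lambda>m. m div d) ` ?S. 1 / (real d * real j))"
    by (subst sum.reindex[OF inj]) (simp add: o_def)
  also have "\<dots> \<le> (\<Sum>j\<in>{1..N}. 1 / (real d * real j))"
  proof (rule sum_mono2)
    show "(\<lambda>m. m div d) ` ?S \<subseteq> {1..N}"
      using assms(1) by (auto simp: Suc_le_eq div_greater_zero_iff intro: order.trans[OF div_le_dividend])
  qed auto
  also have "\<dots> = harm N / real d"
    by (simp add: harm_def sum_divide_distrib field_simps)
  also have "\<dots> \<le> (1 + ln (real N)) / real d"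
    using harm_le_1_plus_ln[OF assms(2)] by (intro divide_right_mono) auto
  finally show ?thesis .
qed

text \<open>A divisor of \<open>g ^ k\<close> is determined by its exponents at the primes dividing
  \<open>g\<close>; there are at most \<open>g\<close> of these, and each exponent is at most
  \<open>k * g\<close>. What matters is polynomial growth in \<open>k\<close> for fixed
  \<open>g\<close>.\<close>

lemma card_divisors_power_le:
  fixes g k :: nat
  assumes "g > 0"
  shows "card {d. d dvd g ^ k} \<le> (k * g + 1) ^ g"
proof -
  let ?P = "prime_factors g"
  have P: "?P \<subseteq> {1..g}" using assms by (auto simp: prime_factors_dvd dvd_imp_le prime_ge_1_nat[simplified])
  have mult_le: "multiplicity p d \<le> k * g" if "p \<in> ?P" "d dvd g ^ k" for p d
  proof -
    have p: "prime p" using that by auto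
    \<comment> \<open>The exponent \<open>v\<close> of \<open>p\<close> in \<open>g\<close>
      satisfies \<open>2 ^ v \<le> g\<close>, hence the generous bound
      \<open>v \<le> g\<close>.\<close>
    have "2 ^ multiplicity p g \<le> p ^ multiplicity p g"
      using prime_ge_2_nat[OF p] by (intro power_mono) auto
    also have "\<dots> \<le> g" using assms by (intro dvd_imp_le multiplicity_dvd) auto
    finally have "multiplicity p g \<le> g" using less_exp[of "multiplicity p g"] by linarith
    moreover have "multiplicity p d \<le> multiplicity p (g ^ k)"
      using that assms by (intro dvd_imp_multiplicity_le) auto
    ultimately show ?thesis
      using p assms by (auto simp: prime_elem_multiplicity_power_distrib intro: order.trans)
  qed
  have "card {d. d dvd g ^ k} \<le> card (?P \<rightarrow>\<^sub>E {..k * g})"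
  proof (rule card_inj_on_le[where f = "\<lambda>d. restrict (\<lambda>p. multiplicity p d) ?P"])
    show "inj_on (\<lambda>d. restrict (\<lambda>p. multiplicity p d) ?P) {d. d dvd g ^ k}"
    proof (rule inj_onI)
      fix d e assume de: "d \<in> {d. d dvd g ^ k}" "e \<in> {d. d dvd g ^ k}"
        and eq: "restrict (\<lambda>p. multiplicity p d) ?P = restrict (\<lambda>p. multiplicity p e) ?P"
      have "multiplicity p d = multiplicity p e" if p: "prime p" for p
      proof (cases "p \<in> ?P")
        case True
        thus ?thesis using fun_cong[OF eq, of p] by simp
      next
        case False
        hence "\<not> p dvd g" using p assms by (simp add: prime_factors_dvd)
        hence "\<not> p dvd g ^ k" using p prime_dvd_power by blast
        hence "\<not> p dvd d" "\<not> p dvd e" using de by (auto dest: dvd_trans)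
        thus ?thesis by (simp add: not_dvd_imp_multiplicity_0)
      qed
      moreover have "d > 0" "e > 0" using de assms by (auto intro!: gr0I)
      ultimately show "d = e" using multiplicity_eq_nat by blast
    qed
    show "(\<lambda>d. restrict (\<lambda>p. multiplicity p d) ?P) ` {d. d dvd g ^ k} \<subseteq> ?P \<rightarrow>\<^sub>E {..k * g}"
    proof (rule image_subsetI)
      fix d assume "d \<in> {d. d dvd g ^ k}"
      hence "\<forall>p\<in>?P. multiplicity p d \<in> {..k * g}"
        using mult_le unfolding mem_Collect_eq atMost_iff by metis
      thus "restrict (\<lambda>p. multiplicity p d) ?P \<in> ?P \<rightarrow>\<^sub>E {..k * g}"
        by (simp only: restrict_PiE_iff)
    qed
    show "finite (?P \<rightarrow>\<^sub>E {..k * g})" by (rule finite_PiE) simp_all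
  qed
  also have "\<dots> = (k * g + 1) ^ card ?P" by (subst card_funcsetE) auto
  also have "\<dots> \<le> (k * g + 1) ^ g"
    by (rule power_increasing) (use card_mono[OF _ P] in auto)
  finally show ?thesis .
qed

text \<open>Replacing the gcd by a sum over all divisors \<open>d\<close> of \<open>g ^ k\<close>
  allows summing over \<open>m\<close> first, with \<open>d\<close> and \<open>a\<close> fixed. This
  \<open>m\<close> runs through a residue class modulo \<open>d\<close> above
  \<open>g ^ k \<ge> d\<close>, and the resulting \<open>1 / d\<close> cancels the factor
  \<open>d\<close> lost in counting \<open>p\<close>.\<close>

lemma sum_missing_multiples_large_le:
  assumes "g \<ge> 2" "b \<in> {1..g - 1}" "N \<ge> 1"
    and I: "\<And>m. m \<in> I \<Longrightarrow> 2 \<le> m \<and> m \<le> N \<and> g ^ k \<le> m \<and> g ^ k \<le> N div m"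
  shows "(\<Sum>m\<in>I. real (card {p \<in> {1..N div m}. b \<notin> set (base_digits g ((p + 1) * sum_proper_divisors m + m))}))
    \<le> 2 * real N * (1 + ln (real N)) * real ((k * g + 1) ^ g) * (1 - 1 / real g) ^ k"
proof -
  let ?\<rho> = "1 - 1 / real g"
  let ?A = "missing_below g b k"
  define D where "D = {d. d dvd g ^ k}"
  have finD: "finite D" using assms(1) by (auto simp: D_def)
  have finI: "finite I" using I by (intro finite_subset[of I "{..N}"]) auto
  have lnN: "ln (real N) \<ge> 0" using assms(3) by simp
  have "(\<Sum>m\<in>I. real (card {p \<in> {1..N div m}. b \<notin> set (base_digits g ((p + 1) * sum_proper_divisors m + m))}))
    \<le> (\<Sum>m\<in>I. \<Sum>d\<in>D. \<Sum>a\<in>?A. if a mod d = m mod d then 2 * real N * real d / (real m * real (g ^ k)) else 0)"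
  proof (rule sum_mono)
    fix m assume "m \<in> I"
    hence m: "m \<ge> 2" "g ^ k \<le> N div m" using I by auto
    define d where "d = gcd (sum_proper_divisors m) (g ^ k)"
    have "real (card {p \<in> {1..N div m}. b \<notin> set (base_digits g ((p + 1) * sum_proper_divisors m + m))})
      \<le> (\<Sum>a | a \<in> ?A \<and> a mod d = m mod d. 2 * real N * real d / (real m * real (g ^ k)))"
      unfolding d_def by (rule card_missing_multiples_le[OF assms(1,2) m])
    also have "\<dots> = (\<Sum>a\<in>?A. if a mod d = m mod d then 2 * real N * real d / (real m * real (g ^ k)) else 0)"
      by (rule sum.inter_filter) simp
    \<comment> \<open>The actual gcd is one element of \<open>D\<close>, and all terms are
      nonnegative.\<close>
    also have "\<dots> \<le> (\<Sum>d\<in>D. \<Sum>a\<in>?A. if a mod d = m mod d then 2 * real N * real d / (real m * real (g ^ k)) else 0)"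
      using finD by (intro member_le_sum) (auto intro!: sum_nonneg simp: D_def d_def)
    finally show "real (card {p \<in> {1..N div m}. b \<notin> set (base_digits g ((p + 1) * sum_proper_divisors m + m))}) \<le> \<dots>" .
  qed
  also have "\<dots> = (\<Sum>d\<in>D. \<Sum>a\<in>?A. \<Sum>m\<in>I. if a mod d = m mod d then 2 * real N * real d / (real m * real (g ^ k)) else 0)"
    by (subst sum.swap, rule sum.cong[OF refl], rule sum.swap)
  also have "\<dots> \<le> (\<Sum>d\<in>D. \<Sum>a\<in>?A. 2 * real N * (1 + ln (real N)) / real (g ^ k))"
  proof (intro sum_mono)
    fix d a assume "d \<in> D"
    hence d: "d > 0" "d \<le> g ^ k" using assms(1) by (auto simp: D_def dvd_imp_le intro!: gr0I)
    have "(\<Sum>m | m \<in> I \<and> a mod d = m mod d. 1 / real m) \<le> (\<Sum>m | m \<in> {d..N} \<and> m mod d = a mod d. 1 / real m)"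
      using I d by (intro sum_mono2) (auto intro: order.trans)
    also have "\<dots> \<le> (1 + ln (real N)) / real d"
      by (rule sum_inverse_residue_class_le[OF d(1) assms(3)])
    finally have le: "(\<Sum>m | m \<in> I \<and> a mod d = m mod d. 1 / real m) \<le> (1 + ln (real N)) / real d" .
    have "(\<Sum>m\<in>I. if a mod d = m mod d then 2 * real N * real d / (real m * real (g ^ k)) else 0)
      = (\<Sum>m | m \<in> I \<and> a mod d = m mod d. 2 * real N * real d / (real m * real (g ^ k)))"
      using finI by (rule sum.inter_filter[symmetric])
    also have "\<dots> = 2 * real N * real d / real (g ^ k) * (\<Sum>m | m \<in> I \<and> a mod d = m mod d. 1 / real m)"
      by (simp add: sum_distrib_left mult_ac)
    also have "\<dots> \<le> 2 * real N * real d / real (g ^ k) * ((1 + ln (real N)) / real d)"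
      by (rule mult_left_mono[OF le]) simp
    also have "\<dots> = 2 * real N * (1 + ln (real N)) / real (g ^ k)"
      using d by simp
    finally show "(\<Sum>m\<in>I. if a mod d = m mod d then 2 * real N * real d / (real m * real (g ^ k)) else 0)
      \<le> 2 * real N * (1 + ln (real N)) / real (g ^ k)" .
  qed
  also have "\<dots> = 2 * real N * (1 + ln (real N)) * real (card D) * (real (card ?A) / real (g ^ k))"
    by simp
  also have "\<dots> \<le> 2 * real N * (1 + ln (real N)) * real ((k * g + 1) ^ g) * ?\<rho> ^ k"
  proof (intro mult_mono mult_left_mono card_missing_below_over_power_le assms(1,2))
    show "real (card D) \<le> real ((k * g + 1) ^ g)"
      unfolding D_def of_nat_le_iff using assms(1) by (intro card_divisors_power_le) auto
  qed (use lnN in auto)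
  finally show ?thesis .
qed

section \<open>Smooth numbers and numbers with a large square divisor\<close>

text \<open>
  Splitting off one factor \<open>p\<close> gives \<open>\<Psi>(A \<union> {p}, N) \<le> \<Psi>(A, N) + \<Psi>(A \<union> {p}, N div p)\<close>, and the bound satisfies
  the matching identity \<open>C + p^-s * C / (1 - p^-s) = C / (1 - p^-s)\<close>.
\<close>
lemma card_smooth_le_prod:
  fixes s :: real and A :: "nat set"
  assumes "finite A" "\<And>p. p \<in> A \<Longrightarrow> p \<ge> 2" "s > 0"
  shows "real (card {n \<in> {1..N}. prime_factors n \<subseteq> A}) \<le> real N powr s * (\<Prod>p\<in>A. 1 / (1 - real p powr -s))"
  using assms(1,2)
proof (induction A arbitrary: N)
  case empty
  have "{n \<in> {1..N}. prime_factors n \<subseteq> {}} \<subseteq> {1..min 1 N}"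
    by (auto simp: prime_factorization_empty_iff)
  hence "card {n \<in> {1..N}. prime_factors n \<subseteq> {}} \<le> card {1..min 1 N}"
    by (intro card_mono) auto
  hence "real (card {n \<in> {1..N}. prime_factors n \<subseteq> {}}) \<le> real (min 1 N)" by simp
  also have "\<dots> \<le> real N powr s"
    using assms(3) ge_one_powr_ge_zero[of "real N" s] by (cases "N = 0") auto
  finally show ?case by simp
next
  case (insert p A)
  have p: "p \<ge> 2" using insert.prems by simp
  define t where "t = real p powr -s"
  have t: "0 < t" "t < 1" using p assms(3) by (auto simp: t_def intro: powr_less_one)
  define P where "P = (\<Prod>p\<in>A. 1 / (1 - real p powr -s))"
  have P: "P \<ge> 0"
    unfolding P_def
  proof (rule prod_nonneg)
    fix q assume "q \<in> A"
    hence "real q > 1" using insert.prems[of q] by simp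
    hence "real q powr -s < 1" using assms(3) by (intro powr_less_one) auto
    thus "0 \<le> 1 / (1 - real q powr -s)" by simp
  qed
  show ?case
  \<comment> \<open>An inner induction on \<open>N\<close>: the multiples of \<open>p\<close> lead
    to \<open>N div p\<close> with the same set \<open>insert p A\<close>.\<close>
  proof (induction N rule: less_induct)
    case (less N)
    show ?case
    proof (cases "N = 0")
      case True
      thus ?thesis by simp
    next
      case False
      have "{n \<in> {1..N}. prime_factors n \<subseteq> insert p A} \<subseteq>
        {n \<in> {1..N}. prime_factors n \<subseteq> A} \<union> (\<lambda>n. p * n) ` {n \<in> {1..N div p}. prime_factors n \<subseteq> insert p A}"
      proof
        fix n assume n: "n \<in> {n \<in> {1..N}. prime_factors n \<subseteq> insert p A}"
        show "n \<in> {n \<in> {1..N}. prime_factors n \<subseteq> A} \<union> (\<lambda>n. p * n) ` {n \<in> {1..N div p}. prime_factors n \<subseteq> insert p A}"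
        proof (cases "p \<in> prime_factors n")
          case False
          thus ?thesis using n by auto
        next
          case True
          then obtain m where m: "n = p * m" by (auto simp: prime_factors_dvd)
          have "m > 0" using n m by (auto intro: gr0I)
          moreover have "m \<le> N div p" using n m p by (simp add: less_eq_div_iff_mult_less_eq mult.commute)
          moreover have "prime_factors m \<subseteq> prime_factors n"
            using n m by (intro dvd_prime_factors) auto
          ultimately show ?thesis using n m by auto
        qed
      qed
      hence "card {n \<in> {1..N}. prime_factors n \<subseteq> insert p A} \<le>
        card ({n \<in> {1..N}. prime_factors n \<subseteq> A} \<union> (\<lambda>n. p * n) ` {n \<in> {1..N div p}. prime_factors n \<subseteq> insert p A})"
        by (intro card_mono) auto
      also have "\<dots> \<le> card {n \<in> {1..N}. prime_factors n \<subseteq> A} + card ((\<lambda>n. p * n) ` {n \<in> {1..N div p}. prime_factors n \<subseteq> insert p A})"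
        by (rule card_Un_le)
      also have "card ((\<lambda>n. p * n) ` {n \<in> {1..N div p}. prime_factors n \<subseteq> insert p A})
        \<le> card {n \<in> {1..N div p}. prime_factors n \<subseteq> insert p A}"
        by (rule card_image_le) auto
      finally have "real (card {n \<in> {1..N}. prime_factors n \<subseteq> insert p A}) \<le>
        real (card {n \<in> {1..N}. prime_factors n \<subseteq> A}) + real (card {n \<in> {1..N div p}. prime_factors n \<subseteq> insert p A})"
        by simp
      also have "\<dots> \<le> real N powr s * P + real (N div p) powr s * (\<Prod>p\<in>insert p A. 1 / (1 - real p powr -s))"
        unfolding P_def
      proof (intro add_mono insert.IH less.IH)
        show "N div p < N" using False p by simp
      qed (use insert.prems in auto)
      also have "(\<Prod>p\<in>insert p A. 1 / (1 - real p powr -s)) = P / (1 - t)"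
        using insert.hyps by (simp add: P_def t_def)
      also have "real N powr s * P + real (N div p) powr s * (P / (1 - t)) \<le> real N powr s * P + real N powr s * t * (P / (1 - t))"
      proof (intro add_left_mono mult_right_mono)
        have "real (N div p) powr s \<le> (real N / real p) powr s"
          using assms(3) by (intro powr_mono2 of_nat_div_le_of_nat) auto
        also have "\<dots> = real N powr s * t"
          using p by (simp add: t_def powr_divide powr_minus_divide)
        finally show "real (N div p) powr s \<le> real N powr s * t" .
        show "0 \<le> P / (1 - t)" using t P by simp
      qed
      also have "\<dots> = real N powr s * (P / (1 - t))"
        using t by (simp add: field_simps)
      also have "P / (1 - t) = (\<Prod>p\<in>insert p A. 1 / (1 - real p powr -s))"
        using insert.hyps by (simp add: P_def t_def)
      finally show ?thesis .
    qed
  qed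
qed

text \<open>Each factor \<open>1 / (1 - t)\<close> with \<open>t = p powr -s\<close> is at most
  \<open>exp (4 * t)\<close>, and \<open>t \<le> Y powr (1 - s) / p\<close>. Bounding the sum of
  \<open>1 / p\<close> by a harmonic sum is weaker than Mertens, but costs only a bounded power of
  \<open>Y\<close> once \<open>Y powr (1 - s)\<close> is bounded.\<close>

lemma card_smooth_le_exp:
  fixes s :: real
  assumes "1 / 2 \<le> s" "s \<le> 1" "Y \<ge> 1"
  shows "real (card {n \<in> {1..N}. \<forall>p. prime p \<longrightarrow> p dvd n \<longrightarrow> p \<le> Y})
    \<le> real N powr s * exp (4 * real Y powr (1 - s) * ln (real Y))"
proof -
  define A where "A = {p. prime p \<and> p \<le> Y}"
  have A2: "p \<ge> 2" if "p \<in> A" for p using that prime_ge_2_nat by (auto simp: A_def)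
  have finA: "finite A" by (rule finite_subset[of _ "{..Y}"]) (auto simp: A_def)
  have "{n \<in> {1..N}. \<forall>p. prime p \<longrightarrow> p dvd n \<longrightarrow> p \<le> Y} = {n \<in> {1..N}. prime_factors n \<subseteq> A}"
    by (auto simp: A_def prime_factors_dvd)
  hence "real (card {n \<in> {1..N}. \<forall>p. prime p \<longrightarrow> p dvd n \<longrightarrow> p \<le> Y})
    \<le> real N powr s * (\<Prod>p\<in>A. 1 / (1 - real p powr -s))"
    using card_smooth_le_prod[OF finA A2, of s N] assms by simp
  also have "\<dots> \<le> real N powr s * (\<Prod>p\<in>A. exp (4 * real Y powr (1 - s) * (1 / real p)))"
  proof (intro mult_left_mono prod_mono)
    fix p assume p: "p \<in> A"
    define t where "t = real p powr -s"
    have p2: "real p \<ge> 2" "real p \<le> real Y" using A2[OF p] p by (auto simp: A_def)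
    \<comment> \<open>\<open>s \<ge> 1 / 2\<close> and \<open>p \<ge> 2\<close> keep
      \<open>t\<close> away from 1; \<open>3 / 4\<close> works because
      \<open>(4 / 3)\<^sup>2 = 16 / 9 \<le> 2\<close>.\<close>
    have "t \<le> real p powr (-1/2)" unfolding t_def using p2 assms by (intro powr_mono) auto
    also have "\<dots> = 1 / sqrt (real p)" using p2 by (simp add: powr_minus_divide powr_half_sqrt)
    also have "\<dots> \<le> 3 / 4"
    proof -
      have "4 / 3 \<le> sqrt (real p)" using p2 by (intro real_le_rsqrt) (simp add: power2_eq_square)
      hence "1 / sqrt (real p) \<le> 1 / (4 / 3)" using p2 by (intro divide_left_mono) auto
      thus ?thesis by simp
    qed
    finally have t: "t \<le> 3 / 4" "t > 0" using p2 by (auto simp: t_def)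
    have "t = real p powr (1 - s) * (1 / real p)"
      using p2 by (simp add: t_def powr_diff powr_minus field_simps)
    also have "\<dots> \<le> real Y powr (1 - s) * (1 / real p)"
      using p2 assms by (intro mult_right_mono powr_mono2) auto
    finally have tY: "t \<le> real Y powr (1 - s) * (1 / real p)" .
    have "1 / (1 - t) = 1 + t / (1 - t)" using t by (simp add: field_simps)
    also have "\<dots> \<le> exp (t / (1 - t))" by (rule exp_ge_add_one_self)
    also have "exp (t / (1 - t)) \<le> exp (4 * real Y powr (1 - s) * (1 / real p))"
    proof -
      \<comment> \<open>Source of the constant 4: \<open>t \<le> 3 / 4\<close> gives
        \<open>4 * (1 - t) \<ge> 1\<close>.\<close>
      have "t * 1 \<le> t * (4 * (1 - t))" using t by (intro mult_left_mono) auto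
      hence "t / (1 - t) \<le> 4 * t" using t by (simp add: divide_le_eq mult_ac)
      thus ?thesis using tY by simp
    qed
    finally have "1 / (1 - t) \<le> exp (4 * real Y powr (1 - s) * (1 / real p))" .
    thus "0 \<le> 1 / (1 - real p powr -s) \<and> 1 / (1 - real p powr -s) \<le> exp (4 * real Y powr (1 - s) * (1 / real p))"
      using t by (simp add: t_def)
  qed simp
  also have "(\<Prod>p\<in>A. exp (4 * real Y powr (1 - s) * (1 / real p))) = exp (4 * real Y powr (1 - s) * (\<Sum>p\<in>A. 1 / real p))"
    by (simp add: exp_sum[OF finA] sum_distrib_left)
  also have "real N powr s * \<dots> \<le> real N powr s * exp (4 * real Y powr (1 - s) * ln (real Y))"
  proof -
    have "(\<Sum>p\<in>A. 1 / real p) \<le> (\<Sum>n\<in>{2..Y}. 1 / real n)"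
      using A2 by (intro sum_mono2) (auto simp: A_def)
    also have "\<dots> = harm Y - 1"
      using assms(3) sum.atLeast_Suc_atMost[of 1 Y "\<lambda>n. 1 / real n"]
      by (simp add: harm_def field_simps numeral_2_eq_2)
    also have "\<dots> \<le> ln (real Y)" using harm_le_1_plus_ln[OF assms(3)] by simp
    finally have "4 * real Y powr (1 - s) * (\<Sum>p\<in>A. 1 / real p) \<le> 4 * real Y powr (1 - s) * ln (real Y)"
      by (intro mult_left_mono) auto
    thus ?thesis by (intro mult_left_mono) auto
  qed
  finally show ?thesis .
qed

text \<open>Telescoping; the induction carries the stronger bound with
  \<open>- 1 / real N\<close>.\<close>

lemma sum_inverse_squares_le:
  assumes "Y \<ge> (1::nat)"
  shows "(\<Sum>p\<in>{Y<..N}. 1 / real p ^ 2) \<le> 1 / real Y"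
proof (cases "Y \<le> N")
  case True
  hence "(\<Sum>p\<in>{Y<..N}. 1 / real p ^ 2) \<le> 1 / real Y - 1 / real N"
  proof (induction N rule: dec_induct)
    case base
    show ?case by simp
  next
    case (step N)
    have "1 / real (Suc N) ^ 2 \<le> 1 / (real N * real (Suc N))"
      using step.hyps assms by (intro divide_left_mono) (auto simp: power2_eq_square)
    also have "\<dots> = 1 / real N - 1 / real (Suc N)"
      using step.hyps assms by (simp add: field_simps)
    finally have "1 / real (Suc N) ^ 2 \<le> 1 / real N - 1 / real (Suc N)" .
    moreover have "{Y<..Suc N} = insert (Suc N) {Y<..N}" using step.hyps by auto
    ultimately show ?case using step.IH by (simp del: of_nat_Suc)
  qed
  also have "\<dots> \<le> 1 / real Y" by simp
  finally show ?thesis .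
qed auto

text \<open>Union bound over \<open>p\<close> in \<open>{Y<..N}\<close>, with at most
  \<open>N div p\<^sup>2\<close> multiples of \<open>p\<^sup>2\<close> for each.\<close>

lemma card_large_square_divisor_le:
  assumes "Y \<ge> 1"
  shows "real (card {n \<in> {1..N}. \<exists>p>Y. p\<^sup>2 dvd n}) \<le> real N / real Y"
proof -
  have "{n \<in> {1..N}. \<exists>p>Y. p\<^sup>2 dvd n} \<subseteq> (\<Union>p\<in>{Y<..N}. (\<lambda>m. p\<^sup>2 * m) ` {1..N div p\<^sup>2})"
  proof
    fix n assume n: "n \<in> {n \<in> {1..N}. \<exists>p>Y. p\<^sup>2 dvd n}"
    then obtain p m where p: "p > Y" "n = p\<^sup>2 * m" by auto
    have "m > 0" using n p by (auto intro: gr0I)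
    have "p \<le> p\<^sup>2 * m" using p \<open>m > 0\<close> by (simp add: power2_eq_square)
    hence "p \<in> {Y<..N}" using n p by auto
    moreover have "m \<le> N div p\<^sup>2" using n p by (simp add: less_eq_div_iff_mult_less_eq mult.commute)
    ultimately show "n \<in> (\<Union>p\<in>{Y<..N}. (\<lambda>m. p\<^sup>2 * m) ` {1..N div p\<^sup>2})"
      using p \<open>m > 0\<close> by force
  qed
  hence "card {n \<in> {1..N}. \<exists>p>Y. p\<^sup>2 dvd n} \<le> card (\<Union>p\<in>{Y<..N}. (\<lambda>m. p\<^sup>2 * m) ` {1..N div p\<^sup>2})"
    by (intro card_mono) auto
  also have "\<dots> \<le> (\<Sum>p\<in>{Y<..N}. card ((\<lambda>m. p\<^sup>2 * m) ` {1..N div p\<^sup>2}))"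
    by (rule card_UN_le) auto
  also have "\<dots> \<le> (\<Sum>p\<in>{Y<..N}. N div p\<^sup>2)"
  proof (rule sum_mono)
    fix p
    show "card ((\<lambda>m. p\<^sup>2 * m) ` {1..N div p\<^sup>2}) \<le> N div p\<^sup>2"
      using card_image_le[of "{1..N div p\<^sup>2}" "\<lambda>m. p\<^sup>2 * m"] by simp
  qed
  finally have "real (card {n \<in> {1..N}. \<exists>p>Y. p\<^sup>2 dvd n}) \<le> (\<Sum>p\<in>{Y<..N}. real (N div p\<^sup>2))"
    by (simp flip: of_nat_sum)
  also have "\<dots> \<le> (\<Sum>p\<in>{Y<..N}. real N * (1 / real p ^ 2))"
  proof (rule sum_mono)
    fix p
    show "real (N div p\<^sup>2) \<le> real N * (1 / real p ^ 2)"
      using of_nat_div_le_of_nat[of N "p\<^sup>2", where ?'a = real] by simp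
  qed
  also have "\<dots> = real N * (\<Sum>p\<in>{Y<..N}. 1 / real p ^ 2)" by (simp add: sum_distrib_left)
  also have "\<dots> \<le> real N * (1 / real Y)"
    using sum_inverse_squares_le[OF assms] by (intro mult_left_mono) auto
  finally show ?thesis by simp
qed

section \<open>Combining the estimates and choosing the parameters\<close>

text \<open>The four terms bound, in order, the \<open>Y\<close>-smooth \<open>n\<close>, the
  \<open>n\<close> with a large square divisor, and the remaining \<open>n = m * p\<close> with
  \<open>m < g ^ j\<close> and with \<open>m \<ge> g ^ j\<close>. As \<open>p > Y\<close> forces
  \<open>N div m \<ge> Y\<close>, the assumption on \<open>Y\<close> makes the range of
  \<open>p\<close> long enough for both \<open>k = t * j\<close> and \<open>k = j\<close>.\<close>

lemma card_missing_le:
  fixes g b t j Y N :: nat and s \<rho> :: real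
  assumes g: "g \<ge> 2" "b \<in> {1..g - 1}" and s: "1 / 2 \<le> s" "s \<le> 1"
    and N: "N \<ge> 1" and t: "t \<ge> 1" and Y: "g ^ (t * j) \<le> Y"
  defines "\<rho> \<equiv> 1 - 1 / real g"
  shows "real (card {n \<in> {1..N}. composite n \<and> b \<notin> set (base_digits g (sum_proper_divisors n))})
    \<le> real N powr s * exp (4 * real Y powr (1 - s) * ln (real Y)) + real N / real Y
      + 2 * real N * (real g ^ 2 * \<rho> ^ t) ^ j
      + 2 * real N * (1 + ln (real N)) * real ((j * g + 1) ^ g) * \<rho> ^ j"
proof -
  have "g ^ (t * j) > 0" using g by simp
  hence Y1: "Y \<ge> 1" using Y by linarith
  define S where "S = {n \<in> {1..N}. composite n \<and> b \<notin> set (base_digits g (sum_proper_divisors n))}"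
  define S1 where "S1 = {n \<in> {1..N}. \<forall>p. prime p \<longrightarrow> p dvd n \<longrightarrow> p \<le> Y}"
  define S2 where "S2 = {n \<in> {1..N}. \<exists>p>Y. p\<^sup>2 dvd n}"
  define T where "T m = {p \<in> {1..N div m}. b \<notin> set (base_digits g ((p + 1) * sum_proper_divisors m + m))}" for m
  \<comment> \<open>The condition \<open>Y \<le> N div m\<close> is what remains of
    \<open>p > Y\<close> and \<open>m * p \<le> N\<close>.\<close>
  define I where "I = {m \<in> {2..N}. Y \<le> N div m}"
  have "S \<subseteq> (S1 \<union> S2) \<union> (\<Union>m\<in>I. (\<lambda>p. m * p) ` T m)"
  proof
    fix n assume n: "n \<in> S"
    show "n \<in> (S1 \<union> S2) \<union> (\<Union>m\<in>I. (\<lambda>p. m * p) ` T m)"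
    proof (cases "n \<in> S1 \<union> S2")
      case False
      then obtain p where p: "prime p" "p dvd n" "p > Y" "\<not> p\<^sup>2 dvd n"
        using n unfolding S_def S1_def S2_def Un_iff mem_Collect_eq by (meson not_le)
      from p(2) obtain m where "n = p * m" by (rule dvdE)
      hence m: "n = m * p" by (simp add: mult.commute)
      have ndvd: "\<not> p dvd m" using p(4) m by (auto simp: power2_eq_square)
      have "n > 1" "\<not> prime n" "n \<le> N" using n by (auto simp: S_def composite_def)
      \<comment> \<open>Compositeness enters here: \<open>m = 1\<close> would make \<open>n\<close>
        prime.\<close>
      hence "m \<noteq> 0" "m \<noteq> 1" using m p(1) by (metis mult_0 not_less_zero, metis mult_1)
      hence m2: "m \<ge> 2" by simp
      have "p \<le> N div m" using m m2 \<open>n \<le> N\<close> by (simp add: less_eq_div_iff_mult_less_eq mult.commute)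
      moreover have "m \<le> N"
        using m \<open>n \<le> N\<close> prime_gt_0_nat[OF p(1)] by (metis le_trans mult_le_mono2 mult.right_neutral Suc_leI One_nat_def)
      moreover have "sum_proper_divisors n = (p + 1) * sum_proper_divisors m + m"
        unfolding m using sum_proper_divisors_mult_prime[OF p(1) ndvd] m2 by simp
      ultimately have "m \<in> I" "p \<in> T m"
        using n p m2 prime_ge_1_nat[OF p(1)] by (auto simp: I_def T_def S_def)
      thus ?thesis using m by blast
    qed auto
  qed
  moreover have finI: "finite I" "\<And>m. finite (T m)" by (auto simp: I_def T_def)
  ultimately have "card S \<le> card ((S1 \<union> S2) \<union> (\<Union>m\<in>I. (\<lambda>p. m * p) ` T m))"
    by (intro card_mono) (auto simp: S1_def S2_def)
  also have "\<dots> \<le> card S1 + card S2 + (\<Sum>m\<in>I. card (T m))"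
  proof -
    have "card (\<Union>m\<in>I. (\<lambda>p. m * p) ` T m) \<le> (\<Sum>m\<in>I. card ((\<lambda>p. m * p) ` T m))"
      by (rule card_UN_le[OF finI(1)])
    also have "\<dots> \<le> (\<Sum>m\<in>I. card (T m))"
      using finI(2) by (intro sum_mono card_image_le)
    finally show ?thesis
      using card_Un_le[of "S1 \<union> S2" "\<Union>m\<in>I. (\<lambda>p. m * p) ` T m"] card_Un_le[of S1 S2] by linarith
  qed
  finally have "real (card S) \<le> real (card S1) + real (card S2) + (\<Sum>m\<in>I. real (card (T m)))"
    by (simp flip: of_nat_sum of_nat_add)
  moreover have "(\<Sum>m\<in>I. real (card (T m))) = (\<Sum>m | m \<in> I \<and> m < g ^ j. real (card (T m))) + (\<Sum>m | m \<in> I \<and> g ^ j \<le> m. real (card (T m)))"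
    using finI by (subst sum.union_disjoint[symmetric]) (auto intro!: sum.cong)
  moreover have "(\<Sum>m | m \<in> I \<and> m < g ^ j. real (card (T m))) \<le> 2 * real N * (real g ^ 2 * \<rho> ^ t) ^ j"
  proof -
    \<comment> \<open>With \<open>M = g ^ j\<close>, the longer block of \<open>k = t * j\<close>
      digits is to beat the loss \<open>M\<^sup>2\<close>.\<close>
    have "(\<Sum>m | m \<in> I \<and> m < g ^ j. real (card (T m))) \<le> 2 * real N * real (g ^ j) ^ 2 * \<rho> ^ (t * j)"
      unfolding T_def \<rho>_def using g Y by (intro sum_missing_multiples_small_le) (auto simp: I_def)
    also have "real (g ^ j) ^ 2 = (real g ^ 2) ^ j"
      by (simp add: mult.commute flip: power_mult)
    finally show ?thesis by (simp add: power_mult_distrib power_mult mult.assoc)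
  qed
  moreover have "(\<Sum>m | m \<in> I \<and> g ^ j \<le> m. real (card (T m))) \<le> 2 * real N * (1 + ln (real N)) * real ((j * g + 1) ^ g) * \<rho> ^ j"
  proof -
    have "g ^ j \<le> g ^ (t * j)" using g t by (intro power_increasing) auto
    hence "g ^ j \<le> Y" using Y by simp
    thus ?thesis
      unfolding T_def \<rho>_def using g N by (intro sum_missing_multiples_large_le) (auto simp: I_def)
  qed
  moreover have "real (card S1) \<le> real N powr s * exp (4 * real Y powr (1 - s) * ln (real Y))"
    unfolding S1_def by (rule card_smooth_le_exp[OF s Y1])
  moreover have "real (card S2) \<le> real N / real Y"
    unfolding S2_def by (rule card_large_square_divisor_le[OF Y1])
  ultimately show ?thesis unfolding S_def[symmetric] by linarith
qed

text \<open>Only parameters remain to be chosen; the constants depend on \<open>g\<close> alone and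
  serve all digits at once.\<close>

theorem theorem1p5:
  fixes g :: nat
  assumes "g \<ge> 2"
  shows "\<exists>c>0. \<exists>C>0. \<forall>\<^sub>F x::real in at_top. \<forall>a\<^sub>0\<in>{1..g - 1}.
    real (card {n::nat. real n \<le> x \<and> composite n \<and>
        a\<^sub>0 \<notin> set (base_digits g (sum_proper_divisors n))})
      \<le> C * (x * exp (- c * sqrt (ln x)))"
proof -
  define \<rho> where "\<rho> = 1 - 1 / real g"
  have \<rho>: "0 < \<rho>" "\<rho> < 1" using assms by (auto simp: \<rho>_def)
  \<comment> \<open>\<open>\<rho> ^ t\<close> must beat the loss of \<open>g\<^sup>2\<close> per
    unit of \<open>j\<close>. Asking for a product below \<open>\<rho>\<close> gives the small
    \<open>m\<close> the decay \<open>\<rho> ^ j\<close> of the large ones.\<close>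
  have "((\<lambda>t. real g ^ 2 * \<rho> ^ t) \<longlongrightarrow> real g ^ 2 * 0) sequentially"
    using \<rho> by (intro tendsto_intros LIMSEQ_realpow_zero) auto
  hence "eventually (\<lambda>t. real g ^ 2 * \<rho> ^ t < \<rho>) sequentially"
    using \<rho> by (intro order_tendstoD(2)[of _ 0]) auto
  hence "eventually (\<lambda>t. real g ^ 2 * \<rho> ^ t < \<rho> \<and> t \<ge> 1) sequentially"
    using eventually_ge_at_top[of 1] by eventually_elim auto
  then obtain t where t: "real g ^ 2 * \<rho> ^ t < \<rho>" "t \<ge> 1"
    by (auto simp: eventually_at_top_linorder)
  \<comment> \<open>With \<open>L = sqrt (ln x)\<close>, this makes
    \<open>g powr (t * \<gamma> * L) = exp (L / 4)\<close>, so that \<open>j\<close> of size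
    \<open>\<gamma> * L\<close> respects \<open>g ^ (t * j) \<le> Y\<close>.\<close>
  define \<gamma> where "\<gamma> = 1 / (4 * real t * ln (real g))"
  have lng: "ln (real g) > 0" using assms by simp
  have \<gamma>: "\<gamma> > 0" using lng t by (simp add: \<gamma>_def)
  \<comment> \<open>Rewrites the decay:
    \<open>\<rho> powr (\<gamma> * L) = exp (- \<kappa> * L)\<close>.\<close>
  define \<kappa> where "\<kappa> = \<gamma> * - ln \<rho>"
  have \<kappa>: "\<kappa> > 0" using \<gamma> \<rho> by (simp add: \<kappa>_def mult_pos_neg)
  \<comment> \<open>Half of \<open>\<kappa>\<close> is given up for factors polynomial in
    \<open>L\<close>; \<open>1 / 4\<close> comes from the large squares.\<close>
  define c where "c = min (\<kappa> / 2) (1 / 4)"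
  \<comment> \<open>This gives \<open>L \<ge> 8\<close>, hence
    \<open>1 - 4 / L \<ge> 1 / 2\<close>.\<close>
  have "eventually (\<lambda>x::real. x \<ge> exp 64) at_top" by (rule eventually_ge_at_top)
  moreover have "eventually (\<lambda>x. (1 + ln x) * (\<gamma> * sqrt (ln x) * real g + 1) powr real g
      \<le> exp (\<kappa> / 2 * sqrt (ln x))) at_top"
    using \<gamma> \<kappa> assms by real_asymp
  \<comment> \<open>The constant adds 1 for smooth \<open>n\<close>, 2 for large squares, and
    \<open>2 / \<rho>\<close> for each range of \<open>m\<close>.\<close>
  ultimately have "\<forall>\<^sub>F x::real in at_top. \<forall>a\<^sub>0\<in>{1..g - 1}.
    real (card {n::nat. real n \<le> x \<and> composite n \<and>
        a\<^sub>0 \<notin> set (base_digits g (sum_proper_divisors n))})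
      \<le> (3 + 4 / \<rho>) * (x * exp (- c * sqrt (ln x)))"
  proof eventually_elim
    case (elim x)
    define L where "L = sqrt (ln x)"
    have "exp 0 \<le> exp (64 :: real)" by (subst exp_le_cancel_iff) simp
    hence x: "x \<ge> 1" using elim(1) unfolding exp_zero by linarith
    have "ln x \<ge> 64" using elim(1) x by (simp add: ln_ge_iff)
    hence "L \<ge> sqrt 64" unfolding L_def by (rule real_sqrt_le_mono)
    moreover have "sqrt 64 = (8 :: real)" using real_sqrt_abs[of 8] by simp
    ultimately have L: "L \<ge> 8" by simp
    have lnx: "ln x = L ^ 2" using \<open>ln x \<ge> 64\<close> by (simp add: L_def)
    have xL: "x = exp (L ^ 2)" using x by (simp flip: lnx)
    define N where "N = nat \<lfloor>x\<rfloor>"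
    define Y where "Y = nat \<lfloor>exp (L / 4)\<rfloor>"
    define j where "j = nat \<lfloor>\<gamma> * L\<rfloor>"
    \<comment> \<open>With this choice \<open>x powr s\<close> saves \<open>exp (4 * L)\<close>,
      while \<open>Y powr (1 - s)\<close> is at most \<open>exp 1\<close>.\<close>
    define s where "s = 1 - 4 / L"
    have N: "N \<ge> 1" "real N \<le> x" using x by (auto simp: N_def le_nat_iff le_floor_iff)
    have e1: "exp (L / 4) \<ge> 1" using L by simp
    have Y: "Y \<ge> 1" "real Y \<le> exp (L / 4)" using e1 by (auto simp: Y_def le_nat_iff le_floor_iff)
    have "exp (L / 4) < real Y + 1" using e1 by (simp add: Y_def) 
    \<comment> \<open>Rounding down loses at most a factor 2 because
      \<open>Y \<ge> 1\<close>.\<close>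
    hence Y2: "exp (L / 4) \<le> 2 * real Y" using Y(1) by linarith
    have "\<gamma> * L \<ge> 0" using \<gamma> L by simp
    hence j: "real j \<le> \<gamma> * L" "\<gamma> * L < real j + 1" by (auto simp: j_def)
    have s: "1 / 2 \<le> s" "s \<le> 1" using L by (auto simp: s_def field_simps)
    have gY: "g ^ (t * j) \<le> Y"
    proof -
      have "real (g ^ (t * j)) = exp (real t * real j * ln (real g))"
        using assms by (simp add: exp_of_nat_mult[symmetric] flip: powr_realpow of_nat_mult) (simp add: powr_def)
      also have "real t * real j * ln (real g) \<le> real t * (\<gamma> * L) * ln (real g)"
        using j lng by (intro mult_right_mono mult_left_mono) auto
      also have "\<dots> = L / 4" using t lng by (simp add: \<gamma>_def field_simps)
      finally have "real (g ^ (t * j)) \<le> exp (L / 4)" by simp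
      thus ?thesis unfolding Y_def by (simp add: le_nat_iff le_floor_iff)
    qed
    have c: "c \<le> \<kappa> / 2" "c \<le> 1 / 4" by (auto simp: c_def)
    have decay: "exp (- r * L) \<le> exp (- c * L)" if "c \<le> r" for r
      using that L by simp
    \<comment> \<open>The factor \<open>1 / \<rho>\<close> pays for rounding:
      \<open>j > \<gamma> * L - 1\<close>.\<close>
    have \<rho>j: "\<rho> ^ j \<le> exp (- \<kappa> * L) / \<rho>"
    proof -
      have "\<rho> ^ j = \<rho> powr real j" using \<rho> by (simp add: powr_realpow)
      also have "\<dots> \<le> \<rho> powr (\<gamma> * L - 1)"
        using \<rho> j by (intro powr_mono') auto
      also have "\<dots> = exp (- \<kappa> * L) / \<rho>"
        using \<rho> by (simp add: powr_diff) (simp add: powr_def \<kappa>_def mult_ac)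
      finally show ?thesis .
    qed
    have smooth: "real N powr s * exp (4 * real Y powr (1 - s) * ln (real Y)) \<le> x * exp (- c * L)"
    proof -
      have "real N powr s \<le> x powr s" using N s by (intro powr_mono2) auto
      also have "\<dots> = exp (s * L ^ 2)" unfolding xL by (simp add: powr_def)
      also have "s * L ^ 2 = L ^ 2 - 4 * L" using L by (simp add: s_def field_simps power2_eq_square)
      finally have 1: "real N powr s \<le> exp (L ^ 2 - 4 * L)" .
      have "real Y powr (1 - s) \<le> exp (L / 4) powr (1 - s)"
        using Y s by (intro powr_mono2) auto
      also have "\<dots> = exp 1" using L by (simp add: powr_def s_def)
      also have "exp 1 \<le> (3 :: real)" by (rule exp_le)
      finally have 2: "real Y powr (1 - s) \<le> 3" .
      have "ln (real Y) \<le> ln (exp (L / 4))" using Y by (intro ln_mono) auto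
      \<comment> \<open>The exponent is at most \<open>3 * L\<close>; against the saved
        \<open>4 * L\<close> a factor \<open>exp (- L)\<close> is left.\<close>
      hence "4 * real Y powr (1 - s) * ln (real Y) \<le> 4 * 3 * (L / 4)"
        using 2 Y L by (intro mult_mono) auto
      hence "exp (4 * real Y powr (1 - s) * ln (real Y)) \<le> exp (3 * L)" by simp
      hence "real N powr s * exp (4 * real Y powr (1 - s) * ln (real Y)) \<le> exp (L ^ 2 - 4 * L) * exp (3 * L)"
        using 1 by (intro mult_mono) auto
      also have "\<dots> = x * exp (- 1 * L)" unfolding xL by (simp flip: exp_add)
      also have "\<dots> \<le> x * exp (- c * L)" using decay[of 1] c x by (intro mult_left_mono) auto
      finally show ?thesis .
    qed
    have squares: "real N / real Y \<le> 2 * (x * exp (- c * L))"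
    proof -
      have "real N / real Y \<le> x / (exp (L / 4) / 2)" using N Y Y2 x by (intro frac_le) auto
      also have "\<dots> = 2 * (x * exp (- (1 / 4) * L))" by (simp add: exp_minus field_simps)
      also have "\<dots> \<le> 2 * (x * exp (- c * L))" using decay[of "1/4"] c x by (intro mult_left_mono) auto
      finally show ?thesis .
    qed
    have small: "2 * real N * (real g ^ 2 * \<rho> ^ t) ^ j \<le> 2 / \<rho> * (x * exp (- c * L))"
    proof -
      have "(real g ^ 2 * \<rho> ^ t) ^ j \<le> \<rho> ^ j" using t \<rho> by (intro power_mono) auto
      also note \<rho>j
      also have "exp (- \<kappa> * L) / \<rho> \<le> exp (- c * L) / \<rho>"
        using \<rho> c \<kappa> by (intro divide_right_mono decay) auto
      finally have "2 * real N * (real g ^ 2 * \<rho> ^ t) ^ j \<le> 2 * x * (exp (- c * L) / \<rho>)"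
        using N x \<rho> by (intro mult_mono) auto
      thus ?thesis by simp
    qed
    have large: "2 * real N * (1 + ln (real N)) * real ((j * g + 1) ^ g) * \<rho> ^ j \<le> 2 / \<rho> * (x * exp (- c * L))"
    proof -
      have "real ((j * g + 1) ^ g) = (real j * real g + 1) powr real g"
        by (subst powr_realpow) (simp_all add: add_pos_nonneg add.commute)
      also have "\<dots> \<le> (\<gamma> * L * real g + 1) powr real g"
        using j by (intro powr_mono2 add_right_mono mult_right_mono) auto
      finally have "(1 + ln (real N)) * real ((j * g + 1) ^ g) \<le> (1 + ln x) * (\<gamma> * L * real g + 1) powr real g"
        using N x by (intro mult_mono add_left_mono ln_mono) auto
      also have "\<dots> \<le> exp (\<kappa> / 2 * L)" using elim(2) by (simp add: L_def)
      finally have "(1 + ln (real N)) * real ((j * g + 1) ^ g) * \<rho> ^ j \<le> exp (\<kappa> / 2 * L) * (exp (- \<kappa> * L) / \<rho>)"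
        using \<rho>j \<rho> by (intro mult_mono) auto
      also have "\<dots> = exp (- (\<kappa> / 2) * L) / \<rho>" by (simp flip: exp_add add: algebra_simps)
      also have "\<dots> \<le> exp (- c * L) / \<rho>" using \<rho> c by (intro divide_right_mono decay) auto
      finally have "2 * real N * ((1 + ln (real N)) * real ((j * g + 1) ^ g) * \<rho> ^ j) \<le> 2 * x * (exp (- c * L) / \<rho>)"
        using N x \<rho> by (intro mult_mono) auto
      thus ?thesis by (simp only: mult.assoc times_divide_eq_left times_divide_eq_right)
    qed
    show ?case
    proof
      fix b assume b: "b \<in> {1..g - 1}"
      have "{n::nat. real n \<le> x \<and> composite n \<and> b \<notin> set (base_digits g (sum_proper_divisors n))}
        = {n \<in> {1..N}. composite n \<and> b \<notin> set (base_digits g (sum_proper_divisors n))}"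
        using x by (auto simp: N_def composite_def le_nat_iff le_floor_iff)
      hence "real (card {n::nat. real n \<le> x \<and> composite n \<and> b \<notin> set (base_digits g (sum_proper_divisors n))})
        \<le> real N powr s * exp (4 * real Y powr (1 - s) * ln (real Y)) + real N / real Y
          + 2 * real N * (real g ^ 2 * \<rho> ^ t) ^ j
          + 2 * real N * (1 + ln (real N)) * real ((j * g + 1) ^ g) * \<rho> ^ j"
        using card_missing_le[OF assms b s N(1) t(2) gY] by (simp add: \<rho>_def)
      also have "\<dots> \<le> x * exp (- c * L) + 2 * (x * exp (- c * L)) + 2 / \<rho> * (x * exp (- c * L)) + 2 / \<rho> * (x * exp (- c * L))"
        by (intro add_mono smooth squares small large)
      also have "\<dots> = (3 + 4 / \<rho>) * (x * exp (- c * L))" by (simp add: algebra_simps)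
      finally show "real (card {n::nat. real n \<le> x \<and> composite n \<and> b \<notin> set (base_digits g (sum_proper_divisors n))})
        \<le> (3 + 4 / \<rho>) * (x * exp (- c * sqrt (ln x)))" by (simp add: L_def)
    qed
  qed
  moreover have "c > 0" "3 + 4 / \<rho> > 0" using \<kappa> \<rho> by (auto simp: c_def intro: add_pos_pos)
  ultimately show ?thesis by blast
qed

end
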